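(* For every integer $r\geq 2$, \[ R_r(4)\leq \frac{(2r)!}{2^r}\left(\frac{10}{3}-\frac{2(r-2)}{(2r-1)(2r-3)}\right), \] and, asymptotically as $r\to\infty$, \[ R_r(4)\leq \frac{(2r)!}{2^r}\left(\frac{3+e}{2}\right)(1+o(1)). \]
   Context: For integers $r\geq 1$ and $k_1,\dots,k_r\geq 1$, the Ramsey number $R_r(k_1,\dots,k_r)$ is the minimum $N\in\mathbb{N}$ such that every coloring of the edges of the complete graph $K_N$ with $r$ colors $1,\dots,r$ contains, for some $i$, a complete subgraph on $k_i$ vertices all of whose edges have color $i$. The diagonal Ramsey number is $R_r(k)=R_r(k,\dots,k)$. Here $o(1)$ denotes a function tending to $0$ as $r\to\infty$. *)

theory Defs
  imports Complex_Main "HOL-Library.Ramsey"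
begin

text \<open>
  The list \<open>ks\<close> is \<open>[k\<^sub>1, \<dots>, k\<^sub>r]\<close>; its length is the number of colours, and the
  colours are numbered from 0. An edge of the complete graph on \<open>{..<N}\<close> is a
  2-element set of vertices.
\<close>
definition ramsey_number :: "nat list \<Rightarrow> nat" where
  "ramsey_number ks = (LEAST N. partn_lst {..<N} ks 2)"

lemma partn_lst_ramsey_number: "partn_lst {..<ramsey_number ks} ks 2"
  unfolding ramsey_number_def using ramsey_full[of ks 2] by (rule LeastI_ex)

definition diagonal_ramsey :: "nat \<Rightarrow> nat \<Rightarrow> nat" where
  "diagonal_ramsey r k = ramsey_number (replicate r k)"

end

theory Submission
  imports Defs
begin

text \<open>
  Remove a vertex \<open>v\<close> from a colouring without monochromatic cliques of forbidden size: in the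
  neighbourhood of \<open>v\<close> in colour \<open>i\<close> the forbidden size for colour \<open>i\<close> drops by one, and a
  colour whose forbidden size is 2 does not occur at all. Hence the largest number of vertices
  \<open>g s t\<close> for \<open>s\<close> colours avoiding \<open>K\<^sub>4\<close> and \<open>t\<close> colours avoiding \<open>K\<^sub>3\<close> satisfies
  \<open>g s t \<le> 1 + s g (s-1) (t+1) + t g s (t-1)\<close>. With \<open>n = 2s + t\<close>, both \<open>n!/2\<^sup>s\<close> and
  \<open>n!/2\<^sup>s \<cdot> 2s/(n(n-1))\<close> solve the homogeneous recursion; a suitable combination of the two,
  plus a geometric series that absorbs the inhomogeneous term 1, dominates \<open>g\<close> from \<open>n = 4\<close> on.
  The resulting constant \<open>331/120\<close> is already smaller than \<open>(3 + e)/2\<close>.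
\<close>

section \<open>Cliques of one colour and neighbourhoods\<close>

definition mono_free :: "('a set \<Rightarrow> nat) \<Rightarrow> 'a set \<Rightarrow> nat \<Rightarrow> nat \<Rightarrow> bool" where
  "mono_free f V c k \<longleftrightarrow> (\<forall>H \<in> nsets V k. \<not> f ` nsets H 2 \<subseteq> {c})"

lemma mono_free_subset: "mono_free f V c k \<Longrightarrow> W \<subseteq> V \<Longrightarrow> mono_free f W c k"
  unfolding mono_free_def by (meson nsets_mono subsetD)

text \<open>A clique of size \<open>k\<close> in colour \<open>c\<close> inside the
  \<open>c\<close>-neighbourhood of \<open>v\<close> would grow to size \<open>Suc k\<close> by
  adding \<open>v\<close>.\<close>

lemma mono_free_neighbourhood:
  assumes "mono_free f V c (Suc k)" and "v \<in> V"
  shows "mono_free f {w \<in> V - {v}. f {v, w} = c} c k"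
  unfolding mono_free_def
proof (intro ballI notI)
  fix H assume H: "H \<in> nsets {w \<in> V - {v}. f {v, w} = c} k" and sub: "f ` nsets H 2 \<subseteq> {c}"
  have fin: "finite H" and cardH: "card H = k" and HV: "\<And>w. w \<in> H \<Longrightarrow> w \<in> V \<and> w \<noteq> v \<and> f {v, w} = c"
    using H by (auto simp: nsets_def)
  have "insert v H \<in> nsets V (Suc k)"
    using fin cardH HV \<open>v \<in> V\<close> by (auto simp: nsets_def card_insert_if)
  moreover have "f e = c" if e: "e \<in> nsets (insert v H) 2" for e
  proof (cases "v \<in> e")
    case True
    obtain x y where "e = {x, y}" "x \<noteq> y" "x \<in> insert v H" "y \<in> insert v H"
      using e unfolding nsets_2_eq by blast
    with True have "\<exists>w \<in> H. e = {v, w}" by auto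
    then show ?thesis using HV by auto
  next
    case False
    with e have "e \<in> nsets H 2" by (auto simp: nsets_def)
    then show ?thesis using sub by auto
  qed
  ultimately show False using assms(1) unfolding mono_free_def by blast
qed

text \<open>An edge is a clique on two vertices whose only edge is itself.\<close>

lemma mono_free_2:
  assumes "mono_free f V c 2" and "e \<in> nsets V 2"
  shows "f e \<noteq> c"
proof
  assume "f e = c"
  have "e' = e" if "e' \<in> nsets e 2" for e'
    using that assms(2) by (intro card_subset_eq) (auto simp: nsets_def)
  with \<open>f e = c\<close> have "f ` nsets e 2 \<subseteq> {c}" by auto
  then show False using assms unfolding mono_free_def by blast
qed

section \<open>The neighbourhood recursion\<close>

fun es_bound :: "nat \<Rightarrow> nat \<Rightarrow> nat" where
  "es_bound 0 0 = 1"
| "es_bound 0 (Suc t) = 1 + Suc t * es_bound 0 t"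
| "es_bound (Suc s) 0 = 1 + Suc s * es_bound s 1"
| "es_bound (Suc s) (Suc t) = 1 + Suc s * es_bound s (Suc (Suc t)) + Suc t * es_bound (Suc s) t"

text \<open>Truncated subtraction is harmless: \<open>s - 1\<close> and \<open>t - 1\<close> occur
  with the factors \<open>s\<close> and \<open>t\<close>, which vanish in the critical
  cases.\<close>

lemma es_bound_rec:
  "es_bound s t = 1 + s * es_bound (s - 1) (Suc t) + t * es_bound s (t - 1)"
  by (cases s; cases t) auto

text \<open>The colour sets are arbitrary because passing to a neighbourhood either moves a colour
  from \<open>A\<close> to \<open>B\<close> or deletes it from \<open>B\<close>; in both cases
  \<open>2 * card A + card B\<close> drops by one.\<close>

lemma card_le_es_bound:
  fixes f :: "'a set \<Rightarrow> nat"
  assumes "finite V" "finite A" "finite B" "A \<inter> B = {}"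
    and "\<And>e. e \<in> nsets V 2 \<Longrightarrow> f e \<in> A \<union> B"
    and "\<And>c. c \<in> A \<Longrightarrow> mono_free f V c 4"
    and "\<And>c. c \<in> B \<Longrightarrow> mono_free f V c 3"
  shows "card V \<le> es_bound (card A) (card B)"
  using assms
proof (induction "2 * card A + card B" arbitrary: V A B rule: less_induct)
  case less
  note prems = less.prems
  show ?case
  proof (cases "V = {}")
    case True
    then show ?thesis by simp
  next
    case False
    then obtain v where v: "v \<in> V" by auto
    define N where "N c = {w \<in> V - {v}. f {v, w} = c}" for c
    have finN: "finite (N c)" and NV: "N c \<subseteq> V" for c
      using prems(1) by (auto simp: N_def)
    have "V - {v} = (\<Union>c \<in> A \<union> B. N c)"
    proof -
      have "{v, w} \<in> nsets V 2" if "w \<in> V - {v}" for w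
        using that v by (auto simp: nsets_def)
      then have "f {v, w} \<in> A \<union> B" if "w \<in> V - {v}" for w
        using prems(5) that by blast
      then show ?thesis by (auto simp: N_def)
    qed
    moreover have "card (\<Union>c \<in> A \<union> B. N c) = (\<Sum>c \<in> A \<union> B. card (N c))"
      using prems(2,3) finN by (intro card_UN_disjoint) (auto simp: N_def)
    moreover have "card V = Suc (card (V - {v}))"
      using card.remove[OF prems(1) v] .
    ultimately have "card V = 1 + (\<Sum>c \<in> A. card (N c)) + (\<Sum>c \<in> B. card (N c))"
      using prems(2-4) by (simp add: sum.union_disjoint)
    moreover have "card (N c) \<le> es_bound (card A - 1) (Suc (card B))" if c: "c \<in> A" for c
    proof -
      have cards: "card (A - {c}) = card A - 1" "card (insert c B) = Suc (card B)" "card A > 0"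
        using c prems(2-4) by (auto simp: card_gt_0_iff card_insert_if)
      have "card (N c) \<le> es_bound (card (A - {c})) (card (insert c B))"
      proof (rule less.hyps)
        show "2 * card (A - {c}) + card (insert c B) < 2 * card A + card B"
          using cards by linarith
        show "finite (A - {c})" "finite (insert c B)" "(A - {c}) \<inter> insert c B = {}"
          using prems(2-4) by auto
        show "f e \<in> (A - {c}) \<union> insert c B" if "e \<in> nsets (N c) 2" for e
          using prems(5)[of e] that nsets_mono[OF NV] by auto
        show "mono_free f (N c) d 4" if "d \<in> A - {c}" for d
          using prems(6) that NV by (blast intro: mono_free_subset)
        show "mono_free f (N c) d 3" if "d \<in> insert c B" for d
        proof (cases "d = c")
          case True
          have "mono_free f V c (Suc 3)" using prems(6)[OF c] by simp
          then show ?thesis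
            unfolding True N_def by (rule mono_free_neighbourhood[OF _ v])
        next
          case False
          then show ?thesis using prems(7) that NV by (blast intro: mono_free_subset)
        qed
      qed (rule finN)
      then show ?thesis unfolding cards .
    qed
    moreover have "card (N c) \<le> es_bound (card A) (card B - 1)" if c: "c \<in> B" for c
    proof -
      have cards: "card (B - {c}) = card B - 1" "card B > 0"
        using c prems(3) by (auto simp: card_gt_0_iff)
      have "mono_free f V c (Suc 2)" using prems(7)[OF c] by simp
      then have free: "mono_free f (N c) c 2"
        unfolding N_def by (rule mono_free_neighbourhood[OF _ v])
      have "card (N c) \<le> es_bound (card A) (card (B - {c}))"
      proof (rule less.hyps)
        show "2 * card A + card (B - {c}) < 2 * card A + card B"
          using cards by linarith
        show "finite A" "finite (B - {c})" "A \<inter> (B - {c}) = {}"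
          using prems(2-4) by auto
        show "f e \<in> A \<union> (B - {c})" if "e \<in> nsets (N c) 2" for e
          using prems(5)[of e] that nsets_mono[OF NV] mono_free_2[OF free that] by auto
        show "mono_free f (N c) d 4" if "d \<in> A" for d
          using prems(6) that NV by (blast intro: mono_free_subset)
        show "mono_free f (N c) d 3" if "d \<in> B - {c}" for d
          using prems(7) that NV by (blast intro: mono_free_subset)
      qed (rule finN)
      then show ?thesis unfolding cards .
    qed
    ultimately have "card V \<le> 1 + card A * es_bound (card A - 1) (Suc (card B))
        + card B * es_bound (card A) (card B - 1)"
      using sum_bounded_above[of A "\<lambda>c. card (N c)" "es_bound (card A - 1) (Suc (card B))"]
        sum_bounded_above[of B "\<lambda>c. card (N c)" "es_bound (card A) (card B - 1)"]
      by (simp add: add_mono)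
    then show ?thesis using es_bound_rec[of "card A" "card B"] by simp
  qed
qed

text \<open>All \<open>r\<close> colours start in the class avoiding cliques of size 4; one vertex
  beyond the largest possible number forces such a clique.\<close>

lemma diagonal_ramsey_4_le: "diagonal_ramsey r 4 \<le> Suc (es_bound r 0)"
proof -
  have "partn_lst {..<Suc (es_bound r 0)} (replicate r 4) 2"
    unfolding partn_lst_def
  proof (rule ballI)
    fix f assume f: "f \<in> nsets {..<Suc (es_bound r 0)} 2 \<rightarrow> {..<length (replicate r 4)}"
    show "\<exists>i<length (replicate r 4). monochromatic {..<Suc (es_bound r 0)} (replicate r 4 ! i) 2 f i"
    proof (rule ccontr)
      assume contra: "\<not> ?thesis"
      have "card {..<Suc (es_bound r 0)} \<le> es_bound (card {..<r}) (card ({} :: nat set))"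
        using f contra
        by (intro card_le_es_bound[where f = f]) (auto simp: mono_free_def monochromatic_def)
      then show False by simp
    qed
  qed
  then show ?thesis
    unfolding diagonal_ramsey_def ramsey_number_def by (rule Least_le)
qed

section \<open>A closed form dominating the recursion\<close>

lemma two_three_power_le_fact:
  assumes "n \<ge> 5"
  shows "2 ^ (n div 2) * 10 * 3 ^ n \<le> 81 * (fact n :: real)"
  using assms
proof (induction n rule: less_induct)
  case (less n)
  \<comment> \<open>Equality holds at 5 and 6, which fixes the ratio 3 and the constant 81. From
    \<open>m\<close> to \<open>m + 2\<close> the left side grows only by the factor 2 * 9 =
    18.\<close>
  consider "n = 5" | "n = 6" | m where "n = m + 2" "m \<ge> 5"
    using less.prems le_Suc_ex[of 7 n] by (cases "n \<ge> 7") (force, linarith)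
  then show ?case
  proof cases
    case 3
    have "2 ^ (n div 2) * 10 * 3 ^ n = 18 * (2 ^ (m div 2) * 10 * 3 ^ m :: real)"
      using 3 by (simp add: power_add)
    also have "\<dots> \<le> 18 * (81 * fact m)"
      using less.IH[of m] 3 by (intro mult_left_mono) auto
    also have "\<dots> \<le> ((real m + 2) * (real m + 1)) * (81 * fact m)"
    proof (rule mult_right_mono)
      have "6 * 6 \<le> (real m + 2) * (real m + 1)"
        using 3 by (intro mult_mono) auto
      then show "18 \<le> (real m + 2) * (real m + 1)" by simp
    qed simp
    also have "\<dots> = 81 * fact n"
      using 3 by (simp add: algebra_simps)
    finally show ?thesis .
  qed (simp_all add: fact_numeral)
qed

text \<open>This multinomial coefficient counts the words with \<open>s\<close> letters used twice
  and \<open>t\<close> letters used once; splitting by the first letter gives the homogeneous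
  recursion.\<close>

definition es_weight :: "nat \<Rightarrow> nat \<Rightarrow> real" where
  "es_weight s t = fact (2 * s + t) / 2 ^ s"

text \<open>Given the geometric term, 331/120 and 11/4 are the values that make the bound exact at
  (0, 4) and (2, 0), namely 65 and 19.\<close>

definition es_coeff :: "nat \<Rightarrow> nat \<Rightarrow> real" where
  "es_coeff s t = 331/120 - 81/20 / 3 ^ (2 * s + t)
     + 11/4 * real s / (real (2 * s + t) * (real (2 * s + t) - 1))"

lemma es_weight_mult_coeff_step:
  assumes n: "n = 2 * s + t" "n \<ge> 5"
  shows "real s * (es_weight (s - 1) (Suc t) * es_coeff (s - 1) (Suc t))
       + real t * (es_weight s (t - 1) * es_coeff s (t - 1)) + 1
     \<le> es_weight s t * es_coeff s t"
proof -
  obtain m where m: "n = Suc m" "m \<ge> 4" using n(2) by (cases n) auto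
  define w :: real where "w = fact m / 2 ^ s"
  \<comment> \<open>The part of \<open>es_coeff\<close> depending only on the total, taken at
    \<open>n - 1\<close>; hence the factor 3.\<close>
  define K :: real where "K = 331/120 - 3 * (81/20 / 3 ^ n)"
  define q :: real where "q = real m * (real m - 1)"
  have q: "q > 0" unfolding q_def using m by (intro mult_pos_pos) auto
  have a: "real s * (es_weight (s - 1) (Suc t) * es_coeff (s - 1) (Suc t))
      = 2 * real s * w * (K + 11/4 * (real s - 1) / q)"
  proof (cases s)
    case (Suc s')
    then have m': "2 * s' + Suc t = m" using n m by simp
    have "es_weight s' (Suc t) = 2 * w"
      unfolding es_weight_def m' w_def Suc by simp
    moreover have "es_coeff s' (Suc t) = K + 11/4 * real s' / q"
      unfolding es_coeff_def m' K_def q_def m by simp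
    moreover have "real (Suc s') - 1 = real s'" by simp
    ultimately show ?thesis
      unfolding Suc diff_Suc_1 by (simp only: mult_ac)
  qed simp
  have b: "real t * (es_weight s (t - 1) * es_coeff s (t - 1))
      = real t * w * (K + 11/4 * real s / q)"
  proof (cases t)
    case (Suc t')
    then have m': "2 * s + t' = m" using n m by simp
    have "es_weight s t' = w"
      unfolding es_weight_def m' w_def by simp
    moreover have "es_coeff s t' = K + 11/4 * real s / q"
      unfolding es_coeff_def m' K_def q_def m by simp
    ultimately show ?thesis
      using Suc by simp
  qed simp
  have weight: "es_weight s t = real n * w"
    using n m by (simp add: es_weight_def w_def flip: n(1))
  have coeff: "es_coeff s t = K + 81/10 / 3 ^ n + 11/4 * real s / (real n * real m)"
    using n m by (simp add: es_coeff_def K_def flip: n(1))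
  \<comment> \<open>The homogeneous recursion holds exactly, since 2s + t = n and 2s(s - 1) + ts =
    s(n - 2).\<close>
  have main: "2 * real s * w * (K + 11/4 * (real s - 1) / q) + real t * w * (K + 11/4 * real s / q)
      = real n * w * (K + 11/4 * real s / (real n * real m))"
  proof -
    have t: "real t = real m + 1 - 2 * real s" using n m by simp
    have "2 * real s * (real s - 1) + real t * real s = real s * (real m - 1)"
      unfolding t by (simp add: algebra_simps)
    then have "(2 * real s * (real s - 1) + real t * real s) / q = real s / real m"
      using m by (simp add: q_def)
    moreover have "real n * (real s / (real n * real m)) = real s / real m"
      using m by simp
    ultimately have "(2 * real s * (real s - 1) + real t * real s) / q
        = real n * (real s / (real n * real m))" by simp
    moreover have "2 * real s * w * (K + 11/4 * (real s - 1) / q) + real t * w * (K + 11/4 * real s / q)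
        = w * ((2 * real s + real t) * K + 11/4 * ((2 * real s * (real s - 1) + real t * real s) / q))"
      by (simp add: algebra_simps add_divide_distrib diff_divide_distrib)
    moreover have "2 * real s + real t = real n" using n by simp
    moreover have "real n * w * (K + 11/4 * z) = w * (real n * K + 11/4 * (real n * z))" for z
      by (simp add: algebra_simps)
    ultimately show ?thesis by (simp only: times_divide_eq_right[symmetric])
  qed
  \<comment> \<open>The geometric term shrinks from \<open>n - 1\<close> to \<open>n\<close> by (3 -
    1) * 81/20 / 3^n; this gain pays for the inhomogeneous 1.\<close>
  have "1 \<le> real n * w * (81/10 / 3 ^ n)"
  proof -
    have "(2::real) ^ s \<le> 2 ^ (n div 2)" using n by (intro power_increasing) auto
    then have "2 ^ s * 10 * 3 ^ n \<le> 2 ^ (n div 2) * 10 * (3::real) ^ n" by simp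
    also have "\<dots> \<le> 81 * fact n" using n two_three_power_le_fact by blast
    also have "fact n = real n * w * 2 ^ s" using m by (simp add: w_def)
    finally have "(10 * 3 ^ n) * 2 ^ s \<le> (81 * (real n * w)) * 2 ^ s" by (simp add: mult_ac)
    then have "10 * 3 ^ n \<le> 81 * (real n * w)" by simp
    then show ?thesis by (simp add: field_simps)
  qed
  then show ?thesis
    unfolding a b weight coeff main by (simp add: algebra_simps)
qed

lemma es_bound_base: "es_bound 0 4 = 65" "es_bound 1 2 = 35" "es_bound 2 0 = 19"
proof -
  have s0: "es_bound 0 1 = 2" by simp
  have s2: "es_bound 0 2 = 5" using es_bound_rec[of 0 2] s0 by simp
  have s3: "es_bound 0 3 = 16" using es_bound_rec[of 0 3] s2 by simp
  show "es_bound 0 4 = 65" using es_bound_rec[of 0 4] s3 by simp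
  have t0: "es_bound 1 0 = 3" by simp
  have t1: "es_bound 1 1 = 9"
    using es_bound_rec[of 1 1] s2 t0 by (simp only: Suc_1 diff_self_eq_0 One_nat_def[symmetric])
  show "es_bound 1 2 = 35"
    using es_bound_rec[of 1 2] s3 t1 by simp
  show "es_bound 2 0 = 19"
    using es_bound_rec[of 2 0] t1 by simp
qed

text \<open>Induction starts at total 4: the estimate fails at (0, 3), where it would give 15.65
  against the value 16.\<close>

lemma es_bound_le:
  assumes "2 * s + t \<ge> 4"
  shows "real (es_bound s t) \<le> es_weight s t * es_coeff s t"
  using assms
proof (induction "2 * s + t" arbitrary: s t rule: less_induct)
  case less
  show ?case
  proof (cases "2 * s + t = 4")
    case True
    then consider "s = 0" "t = 4" | "s = 1" "t = 2" | "s = 2" "t = 0"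
      by (cases s; cases "s - 1") auto
    then show ?thesis
      by cases (simp_all add: es_weight_def es_coeff_def fact_numeral es_bound_base[simplified])
  next
    case False
    with less.prems have n: "2 * s + t \<ge> 5" by simp
    have "real s * real (es_bound (s - 1) (Suc t))
        \<le> real s * (es_weight (s - 1) (Suc t) * es_coeff (s - 1) (Suc t))"
    proof (cases s)
      case (Suc s')
      show ?thesis
        using less.hyps[of s' "Suc t"] n Suc by (intro mult_left_mono) auto
    qed simp
    moreover have "real t * real (es_bound s (t - 1))
        \<le> real t * (es_weight s (t - 1) * es_coeff s (t - 1))"
    proof (cases t)
      case (Suc t')
      show ?thesis
        using less.hyps[of s t'] n Suc by (intro mult_left_mono) auto
    qed simp
    ultimately show ?thesis
      using es_weight_mult_coeff_step[OF refl n] es_bound_rec[of s t] by simp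
  qed
qed

section \<open>Numerical estimates for the diagonal case\<close>

lemma es_weight_Suc_0: "es_weight (Suc r) 0 = es_weight r 0 * ((real r + 1) * (2 * real r + 1))"
proof -
  have "(fact (2 * Suc r) :: real) = 2 * ((real r + 1) * (2 * real r + 1)) * fact (2 * r)"
    by (simp add: algebra_simps)
  then show ?thesis by (simp add: es_weight_def del: fact_Suc mult_Suc_right)
qed

lemma es_weight_2_0: "es_weight 2 0 = 6"
  by (simp add: es_weight_def fact_numeral)

lemma es_weight_3_0: "es_weight 3 0 = 90"
  by (simp add: es_weight_def fact_numeral)

text \<open>Lets the extra vertex be absorbed into an error term of order 1/r.\<close>

lemma es_weight_ge_linear: "r \<ge> 2 \<Longrightarrow> 2 * real r - 1 \<le> es_weight r 0"
proof (induction r rule: nat_induct_at_least)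
  case (Suc r)
  have "2 * real (Suc r) - 1 \<le> 1 * ((real r + 1) * (2 * real r + 1))"
    by (simp add: algebra_simps)
  also have "\<dots> \<le> es_weight r 0 * ((real r + 1) * (2 * real r + 1))"
    using Suc by (intro mult_right_mono) auto
  finally show ?case by (simp only: es_weight_Suc_0)
qed (simp add: es_weight_2_0)

text \<open>Lets the extra vertex cost at most 1/90 in the coefficient.\<close>

lemma es_weight_ge_90: "r \<ge> 3 \<Longrightarrow> 90 \<le> es_weight r 0"
proof (induction r rule: nat_induct_at_least)
  case (Suc r)
  have "90 * 1 \<le> es_weight r 0 * ((real r + 1) * (2 * real r + 1))"
    using Suc by (intro mult_mono) (auto simp: algebra_simps)
  then show ?case by (simp only: es_weight_Suc_0)
qed (simp add: es_weight_3_0)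

lemma es_coeff_0:
  assumes "r \<ge> 2"
  shows "es_coeff r 0 \<le> 331/120 + 11/8 / (2 * real r - 1)"
proof -
  have "11/4 * real r / (real (2 * r) * (2 * real r - 1)) = 11/8 / (2 * real r - 1)"
    using assms by simp
  then show ?thesis by (simp add: es_coeff_def)
qed

lemma diagonal_ramsey_4_le_weight:
  assumes "r \<ge> 2"
  shows "real (diagonal_ramsey r 4) \<le> es_weight r 0 * es_coeff r 0 + 1"
proof -
  have "real (diagonal_ramsey r 4) \<le> real (Suc (es_bound r 0))"
    using diagonal_ramsey_4_le by (rule of_nat_mono)
  then show ?thesis using es_bound_le[of r 0] assms by simp
qed

lemma diagonal_ramsey_4_le_explicit:
  assumes "r \<ge> 2"
  shows "real (diagonal_ramsey r 4) \<le> es_weight r 0 *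
           (10/3 - 2 * (real r - 2) / ((2 * real r - 1) * (2 * real r - 3)))"
\<comment> \<open>At \<open>r = 2\<close> there is no slack: both bounds equal 20.\<close>
proof (cases "r = 2")
  case True
  have "es_coeff 2 0 = 19/6" by (simp add: es_coeff_def)
  then show ?thesis
    using diagonal_ramsey_4_le_weight[of 2] True by (simp add: es_weight_2_0)
next
  case False
  with assms have r: "r \<ge> 3" by simp
  \<comment> \<open>Here 2/15, and 11/40 below, are the values at \<open>r = 3\<close>; they suffice
    because 331/120 + 11/40 + 1/90 = 137/45 is below 10/3 - 2/15 = 16/5.\<close>
  have "2 * (real r - 2) / ((2 * real r - 1) * (2 * real r - 3)) \<le> 2/15"
  proof -
    have "0 \<le> (4 * real r - 11) * (real r - 3)" using r by (intro mult_nonneg_nonneg) auto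
    then have "15 * (real r - 2) \<le> (2 * real r - 1) * (2 * real r - 3)"
      by (simp add: algebra_simps)
    moreover have "0 < (2 * real r - 1) * (2 * real r - 3)" using r by simp
    ultimately show ?thesis by (simp add: pos_divide_le_eq)
  qed
  moreover have "11/8 / (2 * real r - 1) \<le> 11/40" using r by (simp add: field_simps)
  ultimately have "es_coeff r 0 + 1/90 \<le> 10/3 - 2 * (real r - 2) / ((2 * real r - 1) * (2 * real r - 3))"
    using es_coeff_0[OF assms] by linarith
  then have "es_weight r 0 * (es_coeff r 0 + 1/90) \<le> es_weight r 0 *
      (10/3 - 2 * (real r - 2) / ((2 * real r - 1) * (2 * real r - 3)))"
    using es_weight_ge_90[OF r] by (intro mult_left_mono) auto
  moreover have "es_weight r 0 * es_coeff r 0 + 1 \<le> es_weight r 0 * (es_coeff r 0 + 1/90)"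
    using es_weight_ge_90[OF r] by (simp add: algebra_simps)
  ultimately show ?thesis using diagonal_ramsey_4_le_weight[OF assms] by linarith
qed

text \<open>Squaring a Taylor bound at 1/2 gives 169/64; comparing 331/120 with (3 + e)/2 requires
  only e \<ge> 151/60.\<close>

lemma exp_1_ge: "2.64 \<le> exp (1::real)"
proof -
  have "1 + 1/2 + (1/2)\<^sup>2 / 2 \<le> exp (1/2 :: real)"
    by (rule exp_lower_Taylor_quadratic) simp
  then have "(13/8)\<^sup>2 \<le> (exp (1/2 :: real))\<^sup>2"
    by (intro power_mono) (simp_all add: power2_eq_square)
  also have "\<dots> = exp 1" by (simp flip: exp_double)
  finally show ?thesis by (simp add: power2_eq_square)
qed

lemma diagonal_ramsey_4_le_asymptotic:
  assumes "r \<ge> 2"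
  shows "real (diagonal_ramsey r 4) \<le> es_weight r 0 * ((3 + exp 1) / 2) * (1 + 1 / (2 * real r - 1))"
proof -
  define d where "d = 1 / (2 * real r - 1)"
  have d: "d > 0" using assms by (simp add: d_def)
  have w: "es_weight r 0 > 0" by (simp add: es_weight_def)
  have "1 \<le> es_weight r 0 * d"
    using es_weight_ge_linear[OF assms] assms by (simp add: d_def field_simps)
  moreover have "es_weight r 0 * es_coeff r 0 \<le> es_weight r 0 * (331/120 + 11/8 * d)"
    using es_coeff_0[OF assms] w by (intro mult_left_mono) (auto simp: d_def)
  \<comment> \<open>19/8 is 11/8 from the coefficient plus 1 for the extra vertex; it stays below
    331/120, so the error factor is at most \<open>1 + d\<close>.\<close>
  ultimately have "real (diagonal_ramsey r 4) \<le> es_weight r 0 * (331/120 + 19/8 * d)"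
    using diagonal_ramsey_4_le_weight[OF assms] by (simp add: algebra_simps)
  also have "331/120 + 19/8 * d \<le> 331/120 * (1 + d)"
    using d by (simp add: algebra_simps)
  then have "es_weight r 0 * (331/120 + 19/8 * d) \<le> es_weight r 0 * (331/120 * (1 + d))"
    using w by (intro mult_left_mono) auto
  also have "\<dots> \<le> es_weight r 0 * ((3 + exp 1) / 2 * (1 + d))"
    using w d exp_1_ge by (intro mult_left_mono mult_right_mono) auto
  finally show ?thesis by (simp add: d_def mult_ac)
qed

theorem theorem1p3:
  shows "(\<forall>r::nat. r \<ge> 2 \<longrightarrow>
            real (diagonal_ramsey r 4) \<le>
              fact (2 * r) / 2 ^ r *
                (10 / 3 - 2 * (real r - 2) / ((2 * real r - 1) * (2 * real r - 3)))) \<and>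
         (\<exists>\<epsilon> :: nat \<Rightarrow> real. \<epsilon> \<longlonglongrightarrow> 0 \<and>
            (\<forall>r::nat. r \<ge> 2 \<longrightarrow>
              real (diagonal_ramsey r 4) \<le>
                fact (2 * r) / 2 ^ r * ((3 + exp 1) / 2) * (1 + \<epsilon> r)))"
proof (intro conjI exI[where x = "\<lambda>r. 1 / (2 * real r - 1)"] allI impI)
  show "(\<lambda>r. 1 / (2 * real r - 1)) \<longlonglongrightarrow> 0"
  proof (rule real_tendsto_divide_at_top[OF tendsto_const])
    have "eventually (\<lambda>r. real r \<le> 2 * real r - 1) sequentially"
      using eventually_ge_at_top[of 1] by eventually_elim simp
    then show "filterlim (\<lambda>r. 2 * real r - 1) at_top sequentially"
      by (rule filterlim_at_top_mono[OF filterlim_real_sequentially])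
  qed
next
  fix r :: nat assume r: "r \<ge> 2"
  show "real (diagonal_ramsey r 4) \<le> fact (2 * r) / 2 ^ r *
      (10 / 3 - 2 * (real r - 2) / ((2 * real r - 1) * (2 * real r - 3)))"
    using diagonal_ramsey_4_le_explicit[OF r] unfolding es_weight_def add_0_right .
  show "real (diagonal_ramsey r 4) \<le>
      fact (2 * r) / 2 ^ r * ((3 + exp 1) / 2) * (1 + 1 / (2 * real r - 1))"
    using diagonal_ramsey_4_le_asymptotic[OF r] unfolding es_weight_def add_0_right .
qed

end
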